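(* Let $\mathbb{K}\in\{\mathbb{R},\mathbb{C}\}$, let $M,N,D\ge 1$ and $\Delta D\ge 0$ be integers, and let $\mathbf{a}=(\mathbf{a}_{\mathbf{j}})_{\mathbf{j}\in\{1,\dots,N+1\}^D}$, $\mathbf{a}_{\mathbf{j}}\in\mathbb{K}^{M}$, be the coefficient tensor of a degree-$D$ polynomial system $\mathbf{a}\Pi$ of $M$ equations in $N$ unknowns, with equivalent monomials collected. Let $(\mathbf{Q}_{\mathrm u},\mathbf{Q}^{\mathrm v},\mathbf{r})$ be a Qr factorization of $\mathbf{a}$ of incremental degree $\Delta D$, so that in particular the coefficients transform via the backward unitary factor $\mathbf{Q}^{\mathrm v}$ as $$\mathbf{a}_{\mathbf{j}}=\sum_{\substack{\mathbf{h}\in\{1,\dots,N+1\}^{\Delta D},\ \mathbf{k}\in\{1,\dots,N+1\}^{D+\Delta D}\\ \operatorname{sort}(\mathbf{h},\mathbf{k})=(\mathbf{j},\mathbf{0})}}\mathbf{Q}^{\mathrm v}_{\mathbf{h}}\,\mathbf{r}_{\mathbf{k}}\qquad\text{for all }\mathbf{j}\in\{1,\dots,N+1\}^{D},$$ where $\mathbf{0}=(N+1,\dots,N+1)$ has length $2\Delta D$. Then the zero set of the given system $\mathbf{a}\Pi$ contains the zero set of the triangular system $\mathbf{r}\Pi$: for every $\mathbf{x}\in\mathbb{K}^N$, if $\sum_{\mathbf{k}}\mathbf{r}_{\mathbf{k}}\Pi^{\mathbf{k}}(\mathbf{x},1)=\mathbf{0}$, then $\sum_{\mathbf{j}}\m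athbf{a}_{\mathbf{j}}\Pi^{\mathbf{j}}(\mathbf{x},1)=\mathbf{0}$.
   Context: Multi-indices. For an integer $L\ge 0$, a multi-index of length $L$ is an element of $\{1,\dots,N+1\}^L$ (for $L=0$ there is exactly one, the empty one). Concatenation of multi-indices is written $(\mathbf{i},\mathbf{j})$, and $\operatorname{sort}$ rearranges the entries of a multi-index in ascending (nondecreasing) order. $\mathbf{0}$ used as a multi-index denotes the constant multi-index $(N+1,\dots,N+1)$ of the length required by context. Monomial values. For $\mathbf{x}\in\mathbb{K}^N$ put $x^{(n)}=x_n$ for $1\le n\le N$ and $x^{(N+1)}=1$. For a multi-index $\mathbf{j}=(j_1,\dots,j_L)$ define $\Pi^{\mathbf{j}}(\mathbf{x},1)=x^{(j_1)}x^{(j_2)}\cdots x^{(j_L)}$ (equal to $1$ if $L=0$). Polynomial systems. A family $\mathbf{a}=(\mathbf{a}_{\mathbf{j}})_{\mathbf{j}\in\{1,\dots,N+1\}^L}$ of vectors in $\mathbb{K}^M$ defines the polynomial system $\mathbf{a}\Pi$: $\sum_{\mathbf{j}}\mathbf{a}_{\mathbf{j}}\Pi^{\mathbf{j}}(\mathbf{x},1)=\mathbf{0}$, of $M$ equations in the unknown $\mathbf{x}\in\mathbb{K}^N$; its zero set is the set of all solutions $\mathbf{x}\in\mathbb{K}^N$. Equivalent monomials are collected in $\mathbf{a}$ if $\mathbf{a}_{\mathbf{j}}=\sum_{\mathbf{i}:\ \operatorname{sort}(\mathbf{i})=\mathbf{j}}\mathbf{a}_{\mathbf{i}}$ for all $\mathbf{j}$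 (equivalently, $\mathbf{a}_{\mathbf{j}}=\mathbf{0}$ whenever $\mathbf{j}$ is not in ascending order). Triangularity. A family $\mathbf{r}=(\mathbf{r}_{\mathbf{k}})_{\mathbf{k}\in\{1,\dots,N+1\}^L}$ of vectors in $\mathbb{K}^M$, $L\ge 1$, is upper-triangular if for all $m\in\{1,\dots,M\}$ and all $\mathbf{k}$, $(\mathbf{r}_{\mathbf{k}})_m=\sum_{(n,\mathbf{j}):\ \operatorname{sort}(n,\mathbf{j})=(m,\mathbf{k})}(\mathbf{r}_{\mathbf{j}})_n$, where $n$ ranges over $\{1,\dots,M\}$, $\mathbf{j}$ over $\{1,\dots,N+1\}^L$, and $\operatorname{sort}$ is applied to tuples of positive integers (equivalently, $(\mathbf{r}_{\mathbf{k}})_m=0$ unless $m\le k_1\le k_2\le\dots\le k_L$). Qr factorization. Let $\mathbf{a}$ be of degree $D$ (indexed by $\{1,\dots,N+1\}^D$) with equivalent monomials collected. A Qr factorization of $\mathbf{a}$ of incremental degree $\Delta D$ consists of families of $M\times M$ matrices over $\mathbb{K}$, $\mathbf{Q}_{\mathrm u}=(\mathbf{Q}_{\mathrm u}^{\mathbf{i}})$ (forward unitary factor) and $\mathbf{Q}^{\mathrm v}=(\mathbf{Q}^{\mathrm v}_{\mathbf{h}})$ (backward unitary factor), both indexed by $\{1,\dots,N+1\}^{\Delta D}$, and an upper-triangular family $\mathbf{r}=(\mathbf{r}_{\mathbf{k}})$ of vectors in $\mathbb{K}^M$ indexed by $\{1,\dots,N+1\}^{D+\Delta D}$ (triangular factor),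 such that, with $^*$ denoting the conjugate transpose and $\mathbf{I}$ the $M\times M$ identity matrix: (1) $\mathbf{r}_{\mathbf{k}}=\sum_{\operatorname{sort}(\mathbf{i},\mathbf{j})=\mathbf{k}}(\mathbf{Q}_{\mathrm u}^{\mathbf{i}})^*\mathbf{a}_{\mathbf{j}}$ for all $\mathbf{k}\in\{1,\dots,N+1\}^{D+\Delta D}$; (2) $\mathbf{a}_{\mathbf{j}}=\sum_{\operatorname{sort}(\mathbf{h},\mathbf{k})=(\mathbf{j},\mathbf{0})}\mathbf{Q}^{\mathrm v}_{\mathbf{h}}\mathbf{r}_{\mathbf{k}}$ for all $\mathbf{j}\in\{1,\dots,N+1\}^{D}$, where here $\mathbf{0}$ has length $2\Delta D$; (3) (first unitary identity) $(\mathbf{Q}_{\mathrm u}^{\mathbf{0}})^*\mathbf{Q}_{\mathrm u}^{\mathbf{0}}=\mathbf{I}$; (4) (second unitary identity) for all $\mathbf{k}\in\{1,\dots,N+1\}^{2\Delta D}$, $\sum_{\operatorname{sort}(\mathbf{i},\mathbf{j})=\mathbf{k}}\mathbf{Q}^{\mathrm v}_{\mathbf{i}}(\mathbf{Q}_{\mathrm u}^{\mathbf{j}})^*$ equals $\mathbf{I}$ if $\mathbf{k}=\mathbf{0}$ and the zero matrix otherwise. *)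

theory Defs
  imports "Jordan_Normal_Form.Schur_Decomposition"
begin

text \<open>
  Multi-indices carry the 1-based entries \<open>1, \<dots>, N + 1\<close>, whereas vectors and matrices are
  indexed from 0; hence the shifts \<open>n - 1\<close> below.
\<close>

definition multi_indices :: "nat \<Rightarrow> nat \<Rightarrow> nat list set" where
  "multi_indices N L = {j. set j \<subseteq> {1..N + 1} \<and> length j = L}"

definition zero_index :: "nat \<Rightarrow> nat \<Rightarrow> nat list" where
  "zero_index N L = replicate L (N + 1)"

definition coeff_family :: "nat \<Rightarrow> nat \<Rightarrow> nat \<Rightarrow> (nat list \<Rightarrow> 'a vec) \<Rightarrow> bool" where
  "coeff_family M N L a \<longleftrightarrow> (\<forall>j\<in>multi_indices N L. a j \<in> carrier_vec M)"

definition matrix_family :: "nat \<Rightarrow> nat \<Rightarrow> nat \<Rightarrow> (nat list \<Rightarrow> 'a mat) \<Rightarrow> bool" where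
  "matrix_family M N L Q \<longleftrightarrow> (\<forall>j\<in>multi_indices N L. Q j \<in> carrier_mat M M)"

definition monomial_value :: "nat \<Rightarrow> 'a::comm_semiring_1 vec \<Rightarrow> nat list \<Rightarrow> 'a" where
  "monomial_value N x j = prod_list (map (\<lambda>n. if n = N + 1 then 1 else x $ (n - 1)) j)"

definition zero_set ::
    "nat \<Rightarrow> nat \<Rightarrow> nat \<Rightarrow> (nat list \<Rightarrow> 'a::comm_semiring_1 vec) \<Rightarrow> 'a vec set" where
  "zero_set M N L a =
     {x \<in> carrier_vec N.
        finsum_vec TYPE('a) M (\<lambda>j. monomial_value N x j \<cdot>\<^sub>v a j) (multi_indices N L) = 0\<^sub>v M}"

definition monomials_collected ::
    "nat \<Rightarrow> nat \<Rightarrow> nat \<Rightarrow> (nat list \<Rightarrow> 'a::comm_monoid_add vec) \<Rightarrow> bool" where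
  "monomials_collected M N L a \<longleftrightarrow>
     (\<forall>j\<in>multi_indices N L.
        a j = finsum_vec TYPE('a) M a {i \<in> multi_indices N L. sort i = j})"

text \<open>Here \<open>sort\<close> mixes the equation number with the variable numbers.\<close>

definition upper_triangular_family ::
    "nat \<Rightarrow> nat \<Rightarrow> nat \<Rightarrow> (nat list \<Rightarrow> 'a::comm_monoid_add vec) \<Rightarrow> bool" where
  "upper_triangular_family M N L r \<longleftrightarrow>
     (\<forall>m\<in>{1..M}. \<forall>k\<in>multi_indices N L.
        r k $ (m - 1) =
          (\<Sum>(n, j) \<in> {(n, j). n \<in> {1..M} \<and> j \<in> multi_indices N L \<and> sort (n # j) = m # k}.
             r j $ (n - 1)))"

text \<open>
  The pairs of multi-indices \<open>(i, j)\<close>, of lengths \<open>K\<close> and \<open>L\<close>, with \<open>sort (i, j) = k\<close>.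
\<close>

definition sort_pairs :: "nat \<Rightarrow> nat \<Rightarrow> nat \<Rightarrow> nat list \<Rightarrow> (nat list \<times> nat list) set" where
  "sort_pairs N K L k =
     {(i, j). i \<in> multi_indices N K \<and> j \<in> multi_indices N L \<and> sort (i @ j) = k}"

text \<open>\<open>monoid_mat\<close> is the additive monoid of matrices, so its \<open>finprod\<close> is a finite sum.\<close>

definition finsum_mat :: "nat \<Rightarrow> ('i \<Rightarrow> 'a::comm_monoid_add mat) \<Rightarrow> 'i set \<Rightarrow> 'a mat" where
  "finsum_mat M = finprod (monoid_mat TYPE('a) M M)"

definition Qr_factorization ::
    "nat \<Rightarrow> nat \<Rightarrow> nat \<Rightarrow> nat \<Rightarrow> (nat list \<Rightarrow> 'a::conjugatable_field vec) \<Rightarrow>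
     (nat list \<Rightarrow> 'a mat) \<Rightarrow> (nat list \<Rightarrow> 'a mat) \<Rightarrow> (nat list \<Rightarrow> 'a vec) \<Rightarrow> bool" where
  "Qr_factorization M N D \<Delta>D a Qu Qv r \<longleftrightarrow>
     matrix_family M N \<Delta>D Qu \<and> matrix_family M N \<Delta>D Qv \<and>
     coeff_family M N (D + \<Delta>D) r \<and> upper_triangular_family M N (D + \<Delta>D) r \<and>
     (\<forall>k\<in>multi_indices N (D + \<Delta>D).
        r k = finsum_vec TYPE('a) M (\<lambda>(i, j). mat_adjoint (Qu i) *\<^sub>v a j)
                (sort_pairs N \<Delta>D D k)) \<and>
     (\<forall>j\<in>multi_indices N D.
        a j = finsum_vec TYPE('a) M (\<lambda>(h, k). Qv h *\<^sub>v r k)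
                (sort_pairs N \<Delta>D (D + \<Delta>D) (j @ zero_index N (2 * \<Delta>D)))) \<and>
     mat_adjoint (Qu (zero_index N \<Delta>D)) * Qu (zero_index N \<Delta>D) = 1\<^sub>m M \<and>
     (\<forall>k\<in>multi_indices N (2 * \<Delta>D).
        finsum_mat M (\<lambda>(i, j). Qv i * mat_adjoint (Qu j)) (sort_pairs N \<Delta>D \<Delta>D k) =
          (if k = zero_index N (2 * \<Delta>D) then 1\<^sub>m M else 0\<^sub>m M M))"

end

theory Submission
  imports Defs
begin

text \<open>
  Multiply the triangular system on the left by \<open>\<Sum>h. \<Pi>^h Q\<^sup>v\<^sub>h\<close>. Monomials do not see the order of
  their indices, so sums over concatenated multi-indices can be regrouped along \<open>sort\<close>; after
  inserting the forward transformation of \<open>a\<close>, the second unitary identity collapses the product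
  of the two unitary factors to the identity matrix, and what is left is the original system.
\<close>

lemma finite_multi_indices: "finite (multi_indices N L)"
  unfolding multi_indices_def by (rule finite_lists_length_eq) simp

lemma sort_append_in_multi_indices:
  assumes "i \<in> multi_indices N K" "j \<in> multi_indices N L"
  shows "sort (i @ j) \<in> multi_indices N (K + L)"
  using assms by (auto simp: multi_indices_def)

lemma monomial_value_sort: "monomial_value N x (sort j) = monomial_value N x j"
  unfolding monomial_value_def by (simp flip: prod_mset_prod_list)

lemma monomial_value_append:
  "monomial_value N x (i @ j) = monomial_value N x i * monomial_value N x j"
  by (simp add: monomial_value_def)

lemma monomial_value_zero_index: "monomial_value N x (zero_index N L) = 1"
  by (simp add: monomial_value_def zero_index_def)

lemma zero_index_in_multi_indices: "zero_index N L \<in> multi_indices N L"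
  by (auto simp: multi_indices_def zero_index_def)

lemma sort_pairs_subset: "sort_pairs N K L k \<subseteq> multi_indices N K \<times> multi_indices N L"
  by (auto simp: sort_pairs_def)

lemma finite_sort_pairs: "finite (sort_pairs N K L k)"
  by (rule finite_subset[OF sort_pairs_subset]) (simp add: finite_multi_indices)

text \<open>The sets \<open>sort_pairs N K L k\<close> are the fibres of the map sending
  \<open>(i, j)\<close> to \<open>sort (i @ j)\<close>, and on the fibre over \<open>k\<close> the
  product of the values of \<open>i\<close> and \<open>j\<close> is the value of \<open>k\<close>.
  This regrouping serves twice: for the forward transformation and for the second unitary
  identity.\<close>

lemma sum_sort_pairs:
  fixes f :: "nat list \<Rightarrow> nat list \<Rightarrow> 'a::comm_semiring_1"
  shows "(\<Sum>k\<in>multi_indices N (K + L). monomial_value N x k * (\<Sum>(i, j)\<in>sort_pairs N K L k. f i j)) =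
    (\<Sum>i\<in>multi_indices N K. \<Sum>j\<in>multi_indices N L.
       monomial_value N x i * monomial_value N x j * f i j)"
proof -
  let ?P = "multi_indices N K \<times> multi_indices N L"
  have fib: "sort_pairs N K L k = {p \<in> ?P. sort (fst p @ snd p) = k}" for k
    by (auto simp: sort_pairs_def)
  have "(\<Sum>(i, j)\<in>?P. monomial_value N x i * monomial_value N x j * f i j) =
      (\<Sum>k\<in>multi_indices N (K + L). \<Sum>(i, j)\<in>sort_pairs N K L k.
         monomial_value N x i * monomial_value N x j * f i j)"
    unfolding fib
    by (rule sum.group[symmetric])
      (auto simp: finite_multi_indices intro: sort_append_in_multi_indices)
  also have "\<dots> = (\<Sum>k\<in>multi_indices N (K + L).
      monomial_value N x k * (\<Sum>(i, j)\<in>sort_pairs N K L k. f i j))"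
    unfolding sum_distrib_left
    by (intro sum.cong refl)
      (auto simp: sort_pairs_def simp flip: monomial_value_append monomial_value_sort[of N x "_ @ _"])
  finally show ?thesis
    by (simp add: sum.cartesian_product)
qed

lemma index_finsum_mat:
  fixes f :: "'i \<Rightarrow> 'a::comm_monoid_add mat"
  assumes "finite A" "\<And>x. x \<in> A \<Longrightarrow> f x \<in> carrier_mat M M" "i < M" "j < M"
  shows "finsum_mat M f A $$ (i, j) = (\<Sum>x\<in>A. f x $$ (i, j))"
proof -
  interpret comm_monoid "monoid_mat TYPE('a) M M"
    by (rule comm_monoid_mat)
  \<comment> \<open>Membership in the carrier is part of the induction because an entry of a matrix
    sum splits only when the dimensions are known.\<close>
  have "finsum_mat M f A \<in> carrier_mat M M \<and>
      finsum_mat M f A $$ (i, j) = (\<Sum>x\<in>A. f x $$ (i, j))"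
    using assms(1,2)
  proof (induction A rule: finite_induct)
    case empty
    then show ?case
      using assms(3,4) finprod_empty[of f] by (simp add: finsum_mat_def) (simp add: monoid_mat_def)
  next
    case (insert y A)
    have "finsum_mat M f (insert y A) = f y + finsum_mat M f A"
      unfolding finsum_mat_def
      by (subst finprod_insert) (use insert in \<open>auto simp: monoid_mat_def\<close>)
    with insert assms(3,4) show ?case
      by auto
  qed
  then show ?thesis ..
qed

text \<open>Passing to scalar equations lets the rest of the argument use ordinary finite sums,
  which distribute and swap freely.\<close>

lemma mem_zero_set_iff:
  assumes "coeff_family M N L a"
  shows "x \<in> zero_set M N L a \<longleftrightarrow> x \<in> carrier_vec N \<and>
    (\<forall>m<M. (\<Sum>j\<in>multi_indices N L. monomial_value N x j * a j $ m) = 0)"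
proof -
  let ?S = "finsum_vec TYPE('a) M (\<lambda>j. monomial_value N x j \<cdot>\<^sub>v a j) (multi_indices N L)"
  have a: "a j \<in> carrier_vec M" if "j \<in> multi_indices N L" for j
    using assms that by (simp add: coeff_family_def)
  have "?S \<in> carrier_vec M"
    by (rule finsum_vec_closed) (auto simp: a)
  moreover have "?S $ m = (\<Sum>j\<in>multi_indices N L. monomial_value N x j * a j $ m)"
    if "m < M" for m
    by (subst index_finsum_vec[OF finite_multi_indices that])
      (auto simp: that a carrier_vecD[OF a] intro!: sum.cong)
  ultimately show ?thesis
    unfolding zero_set_def by (auto intro!: eq_vecI)
qed

text \<open>Stated over any \<open>conjugatable_field\<close>, so that the real and the complex case
  are both instances.\<close>

lemma Qr_factorization_zero_set_subset:
  fixes a :: "nat list \<Rightarrow> 'a::conjugatable_field vec"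
  assumes a: "coeff_family M N D a" and Qr: "Qr_factorization M N D \<Delta>D a Qu Qv r"
  shows "zero_set M N (D + \<Delta>D) r \<subseteq> zero_set M N D a"
proof
  fix x assume x: "x \<in> zero_set M N (D + \<Delta>D) r"
  \<comment> \<open>The adjoints enter the computation as plain \<open>M\<close> by \<open>M\<close>
    matrices.\<close>
  define U where "U i = mat_adjoint (Qu i)" for i
  let ?I = "multi_indices N" and ?mon = "monomial_value N x"
  note Qr = Qr[unfolded Qr_factorization_def]
  have aC: "a j \<in> carrier_vec M" if "j \<in> ?I D" for j
    using a that by (simp add: coeff_family_def)
  have U: "U i \<in> carrier_mat M M" if "i \<in> ?I \<Delta>D" for i
  proof -
    have "Qu i \<in> carrier_mat M M"
      using Qr that by (simp add: matrix_family_def)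
    then show ?thesis
      by (auto simp: U_def mat_adjoint_def)
  qed
  have V: "Qv h \<in> carrier_mat M M" if "h \<in> ?I \<Delta>D" for h
    using Qr that by (simp add: matrix_family_def)
  have r: "coeff_family M N (D + \<Delta>D) r"
    using Qr by simp
  \<comment> \<open>The degree is written \<open>\<Delta>D + D\<close>, in the order of the pair
    \<open>(i, j)\<close>, to fit \<open>sum_sort_pairs\<close>.\<close>
  have r_index: "r k $ n = (\<Sum>(i, j)\<in>sort_pairs N \<Delta>D D k. \<Sum>p<M. U i $$ (n, p) * a j $ p)"
    if "k \<in> ?I (\<Delta>D + D)" "n < M" for k n
  proof -
    have "r k = finsum_vec TYPE('a) M (\<lambda>(i, j). U i *\<^sub>v a j) (sort_pairs N \<Delta>D D k)"
      using Qr that by (simp add: U_def add.commute)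
    moreover have "(\<lambda>(i, j). U i *\<^sub>v a j) \<in> sort_pairs N \<Delta>D D k \<rightarrow> carrier_vec M"
      using U aC by (auto simp: sort_pairs_def intro!: mult_mat_vec_carrier)
    ultimately have "r k $ n = (\<Sum>(i, j)\<in>sort_pairs N \<Delta>D D k. (U i *\<^sub>v a j) $ n)"
      using index_finsum_vec[OF finite_sort_pairs \<open>n < M\<close>] by (simp add: case_prod_unfold)
    also have "\<dots> = (\<Sum>(i, j)\<in>sort_pairs N \<Delta>D D k. \<Sum>p<M. U i $$ (n, p) * a j $ p)"
      by (intro sum.cong refl)
        (use that(2) U aC in \<open>force simp: sort_pairs_def scalar_prod_def lessThan_atLeast0\<close>)
    finally show ?thesis .
  qed
  \<comment> \<open>This is equation \<open>n\<close> of the triangular system at \<open>x\<close>,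
    with \<open>r\<close> expressed through \<open>a\<close>.\<close>
  have forward: "(\<Sum>i\<in>?I \<Delta>D. \<Sum>j\<in>?I D. ?mon i * ?mon j * (\<Sum>p<M. U i $$ (n, p) * a j $ p)) = 0"
    if "n < M" for n
  proof -
    have "(\<Sum>k\<in>?I (\<Delta>D + D). ?mon k * r k $ n) = 0"
      using x that by (simp add: mem_zero_set_iff[OF r] add.commute)
    then show ?thesis
      using that by (simp add: r_index flip: sum_sort_pairs)
  qed
  \<comment> \<open>Evaluated at \<open>x\<close>, the two unitary factors become mutually inverse
    matrices.\<close>
  have unitary: "(\<Sum>h\<in>?I \<Delta>D. \<Sum>i\<in>?I \<Delta>D. ?mon h * ?mon i * (\<Sum>n<M. Qv h $$ (m, n) * U i $$ (n, p))) =
      (if m = p then 1 else 0)" if "m < M" "p < M" for m p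
  proof -
    have index: "(\<Sum>(h, i)\<in>sort_pairs N \<Delta>D \<Delta>D k. \<Sum>n<M. Qv h $$ (m, n) * U i $$ (n, p)) =
        (if k = zero_index N (\<Delta>D + \<Delta>D) then if m = p then 1 else 0 else 0)"
      if k: "k \<in> ?I (\<Delta>D + \<Delta>D)" for k
    proof -
      have "(\<Sum>(h, i)\<in>sort_pairs N \<Delta>D \<Delta>D k. \<Sum>n<M. Qv h $$ (m, n) * U i $$ (n, p)) =
          (\<Sum>q\<in>sort_pairs N \<Delta>D \<Delta>D k. (case q of (h, i) \<Rightarrow> Qv h * U i) $$ (m, p))"
        by (intro sum.cong refl)
          (use \<open>m < M\<close> \<open>p < M\<close> U V in
            \<open>force simp: sort_pairs_def scalar_prod_def lessThan_atLeast0\<close>)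
      also have "\<dots> = finsum_mat M (\<lambda>(h, i). Qv h * U i) (sort_pairs N \<Delta>D \<Delta>D k) $$ (m, p)"
        by (rule index_finsum_mat[symmetric])
          (use \<open>m < M\<close> \<open>p < M\<close> U V finite_sort_pairs in
            \<open>auto simp: sort_pairs_def intro!: mult_carrier_mat\<close>)
      also have "\<dots> = (if k = zero_index N (\<Delta>D + \<Delta>D) then 1\<^sub>m M else 0\<^sub>m M M) $$ (m, p)"
        using Qr k by (simp add: U_def mult_2)
      finally show ?thesis
        using \<open>m < M\<close> \<open>p < M\<close> by auto
    qed
    \<comment> \<open>After regrouping by \<open>k\<close>, only the constant monomial
      \<open>zero_index\<close> survives, and its value is 1.\<close>
    show ?thesis
      by (simp add: index finite_multi_indices zero_index_in_multi_indices
          monomial_value_zero_index if_distrib[of "\<lambda>c. _ * c"] flip: sum_sort_pairs cong: if_cong)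
  qed
  have "(\<Sum>j\<in>?I D. ?mon j * a j $ m) = 0" if "m < M" for m
  proof -
    let ?t = "\<lambda>h n i j p.
      ?mon h * Qv h $$ (m, n) * (?mon i * ?mon j * (U i $$ (n, p) * a j $ p))"
    \<comment> \<open>For fixed \<open>h\<close> and \<open>n\<close>, the three inner sums are a
      multiple of \<open>forward\<close>. The same fivefold sum is now reordered so that
      \<open>unitary\<close> applies instead.\<close>
    have "0 = (\<Sum>h\<in>?I \<Delta>D. \<Sum>n<M. \<Sum>i\<in>?I \<Delta>D. \<Sum>j\<in>?I D. \<Sum>p<M. ?t h n i j p)"
      by (simp add: forward flip: sum_distrib_left)
    also have "\<dots> = (\<Sum>h\<in>?I \<Delta>D. \<Sum>i\<in>?I \<Delta>D. \<Sum>n<M. \<Sum>j\<in>?I D. \<Sum>p<M. ?t h n i j p)"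
      by (intro sum.cong refl sum.swap)
    \<comment> \<open>Packing the indices into two product sets lets a single swap move
      \<open>(j, p)\<close> outside \<open>(h, i, n)\<close>.\<close>
    also have "\<dots> = (\<Sum>(h, i, n)\<in>?I \<Delta>D \<times> ?I \<Delta>D \<times> {..<M}. \<Sum>(j, p)\<in>?I D \<times> {..<M}. ?t h n i j p)"
      by (simp flip: sum.cartesian_product)
    also have "\<dots> = (\<Sum>(j, p)\<in>?I D \<times> {..<M}. \<Sum>(h, i, n)\<in>?I \<Delta>D \<times> ?I \<Delta>D \<times> {..<M}. ?t h n i j p)"
      unfolding case_prod_unfold by (rule sum.swap)
    also have "\<dots> = (\<Sum>j\<in>?I D. \<Sum>p<M. \<Sum>h\<in>?I \<Delta>D. \<Sum>i\<in>?I \<Delta>D. \<Sum>n<M. ?t h n i j p)"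
      by (simp flip: sum.cartesian_product)
    also have "\<dots> = (\<Sum>j\<in>?I D. \<Sum>p<M. ?mon j * a j $ p *
        (\<Sum>h\<in>?I \<Delta>D. \<Sum>i\<in>?I \<Delta>D. ?mon h * ?mon i * (\<Sum>n<M. Qv h $$ (m, n) * U i $$ (n, p))))"
      by (simp add: sum_distrib_left mult_ac)
    \<comment> \<open>The inner double sum is now a Kronecker delta, which selects
      \<open>p = m\<close>.\<close>
    also have "\<dots> = (\<Sum>j\<in>?I D. ?mon j * a j $ m)"
      using that by (simp add: unitary if_distrib[of "\<lambda>c. _ * c"] cong: if_cong)
    finally show ?thesis ..
  qed
  with x show "x \<in> zero_set M N D a"
    by (simp add: mem_zero_set_iff[OF a] mem_zero_set_iff[OF r])
qed

theorem theorem2: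
  fixes M N D \<Delta>D :: nat
  assumes "M \<ge> 1" and "N \<ge> 1" and "D \<ge> 1"
  shows
    "(\<forall>(a :: nat list \<Rightarrow> real vec) Qu Qv r.
        coeff_family M N D a \<longrightarrow> monomials_collected M N D a \<longrightarrow>
        Qr_factorization M N D \<Delta>D a Qu Qv r \<longrightarrow>
        zero_set M N (D + \<Delta>D) r \<subseteq> zero_set M N D a) \<and>
     (\<forall>(a :: nat list \<Rightarrow> complex vec) Qu Qv r.
        coeff_family M N D a \<longrightarrow> monomials_collected M N D a \<longrightarrow>
        Qr_factorization M N D \<Delta>D a Qu Qv r \<longrightarrow>
        zero_set M N (D + \<Delta>D) r \<subseteq> zero_set M N D a)"
  by (intro conjI allI impI; rule Qr_factorization_zero_set_subset)

end
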